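(* Let $\xi\neq 0$ be a real number, and let $\alpha=\frac{p}{q}>1$ be a rational number, where $p,q$ are integers with $\gcd(p,q)=1$ and $q\geq 1$. Let $\eta$ be a real number such that $(p-q)|\eta|<1$. Additionally, if $q=1$ (that is, $\alpha=p$ is an integer), suppose that $v_p(\xi)<\infty$. Then there exist $\delta_1\in(0,\frac{1}{2})$ depending only on $\alpha$ and $\eta$, and a constant $C=C(\alpha,\xi)>0$ depending only on $\alpha$ and $\xi$, such that $$\#\left\{1\leq n\leq N:\ \|\xi \alpha^{n}-\eta\|\geq\delta_1\right\}\geq \lfloor C\log N\rfloor$$ holds for all positive integers $N$.
   Context: For a real number $x$, $\|x\|$ denotes the distance from $x$ to its nearest integer. In the counting set, $n$ ranges over integers. For an integer $b\geq 2$ and a real number $\xi$, the base-$b$ Diophantine exponent $v_b(\xi)$ is the supremum (possibly $+\infty$) of the set of all real numbers $v$ for which the inequality $\|b^n\xi\|<(b^n)^{-v}$ holds for infinitely many positive integers $n$. *)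

theory Defs
  imports Complex_Main "HOL-Library.Extended_Real"
begin

definition dist_nearest_int :: "real \<Rightarrow> real" where
  "dist_nearest_int x = \<bar>x - of_int (round x)\<bar>"

(* Meaningful for b >= 2.  The set always contains all v <= 0, so the supremum is never the
   supremum of the empty set. *)
definition diophantine_exponent :: "int \<Rightarrow> real \<Rightarrow> ereal" where
  "diophantine_exponent b \<xi> =
     Sup (ereal ` {v. infinite {n::nat. n > 0 \<and>
       dist_nearest_int (of_int b ^ n * \<xi>) < (of_int b ^ n) powr (- v)}})"

end

theory Submission
  imports Defs
begin

text \<open>
  Call \<open>n\<close> \<^emph>\<open>close\<close> when \<open>\<xi> \<alpha>\<^sup>n\<close> lies within \<open>\<delta>\<close> of \<open>\<eta> + a\<^sub>n\<close>, where \<open>a\<^sub>n\<close> is an integer. Since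
  \<open>q \<xi> \<alpha>\<^bsup>n+1\<^esup> = p \<xi> \<alpha>\<^sup>n\<close>, the integer \<open>q a\<^bsub>n+1\<^esub> - p a\<^sub>n\<close> differs from \<open>(p - q) \<eta>\<close> by at most
  \<open>(p + q) \<delta>\<close> whenever \<open>n\<close> and \<open>n + 1\<close> are both close. The hypothesis \<open>(p - q) \<bar>\<eta>\<bar> < 1\<close> leaves room
  for a \<open>\<delta>\<close>, depending on \<open>\<alpha>\<close> and \<open>\<eta>\<close> only, that makes this integer smaller than \<open>1\<close> in absolute
  value, hence zero (\<open>consecutive_nearest_integers\<close>). So along a run of close indices
  \<open>m, \<dots>, m + k\<close> the integers \<open>a\<^sub>n\<close> form a geometric progression of ratio \<open>p/q\<close>
  (\<open>nearest_integers_along_run\<close>), and this bounds the length of the run linearly in \<open>m\<close>: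

  \<^item> if \<open>q \<ge> 2\<close>, coprimality gives \<open>q\<^sup>k dvd a\<^sub>m\<close>, while \<open>a\<^sub>m\<close> is nonzero for large \<open>m\<close> and at most
    exponential in \<open>m\<close> (\<open>run_length_nonintegral_ratio\<close>);

  \<^item> if \<open>q = 1\<close>, the distance from \<open>\<xi> p\<^sup>m\<close> to \<open>a\<^sub>m\<close> is multiplied by \<open>p\<close> at each step and stays
    bounded, so that it is at most of order \<open>p\<^bsup>-k\<^esup>\<close> at the start, while the finiteness of the Diophantine
    exponent bounds it from below by \<open>p\<^bsup>-Vm\<^esup>\<close> (\<open>run_length_integral_ratio\<close>).

  Consequently every interval \<open>[m, K m]\<close> with \<open>m\<close> large contains an index that is not close, and
  disjoint intervals of this kind, growing geometrically, give the logarithmic lower bound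
  (\<open>log_count_of_bounded_ratio_gaps\<close>). Since \<open>\<bar>\<eta>\<bar> < 1\<close>, none of the bounds on runs involves \<open>\<eta>\<close>,
  so that \<open>C\<close> depends on \<open>\<alpha>\<close> and \<open>\<xi>\<close> only.
\<close>

section \<open>Sets that meet every long multiplicative interval\<close>

text \<open>
  With \<open>L > K\<close> and \<open>L \<ge> m\<^sub>0\<close>, the set \<open>S\<close> meets each of the disjoint intervals \<open>[L\<^sup>j, L\<^bsup>j+1\<^esup>)\<close> with
  \<open>j \<ge> 1\<close>, and so has at least \<open>J - 1\<close> elements below \<open>L\<^sup>J\<close>. The factor \<open>1/2\<close> in \<open>C\<close> absorbs the lost
  interval and makes the claim trivial for small \<open>N\<close>.
\<close>

lemma log_count_of_bounded_ratio_gaps: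
  fixes K m0 :: nat
  shows "\<exists>C::real. C > 0 \<and> (\<forall>S. (\<forall>m\<ge>m0. \<exists>n\<in>S. m \<le> n \<and> n \<le> K * m) \<longrightarrow>
           (\<forall>N\<ge>1. int (card {n::nat. 1 \<le> n \<and> n \<le> N \<and> n \<in> S}) \<ge> \<lfloor>C * ln (real N)\<rfloor>))"
proof -
  define L :: nat where "L = K + m0 + 2"
  define C :: real where "C = 1 / (2 * ln (real L))"
  have L2: "L \<ge> 2" "L > K" "L \<ge> m0" by (simp_all add: L_def)
  have lnL: "ln (real L) > 0" using L2 by simp
  have "C > 0" using lnL by (simp add: C_def)
  moreover have "int (card {n::nat. 1 \<le> n \<and> n \<le> N \<and> n \<in> S}) \<ge> \<lfloor>C * ln (real N)\<rfloor>"
    if gaps: "\<forall>m\<ge>m0. \<exists>n\<in>S. m \<le> n \<and> n \<le> K * m" and N: "N \<ge> 1" for S :: "nat set" and N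
  proof -
    obtain J where J: "L ^ J \<le> N" "N < L ^ Suc J"
      using ex_power_ivl1[OF L2(1) N] by auto
    have "real N < real L ^ Suc J"
      using J(2) by (metis of_nat_less_iff of_nat_power)
    hence "ln (real N) < ln (real L ^ Suc J)"
      using N by simp
    also have "\<dots> = real (Suc J) * ln (real L)"
      using L2 by (subst ln_realpow) auto
    finally have "C * ln (real N) < real (Suc J) / 2"
      using lnL by (simp add: C_def field_simps)
    hence floor_le: "\<lfloor>C * ln (real N)\<rfloor> \<le> int (J - 1)"
      by (cases J) (auto simp: floor_le_iff)
    have "\<exists>n\<in>S. L ^ j \<le> n \<and> n < L ^ Suc j" if "j \<ge> 1" for j
    proof -
      have "m0 \<le> L ^ j"
        using L2 power_increasing[OF that, of L] by simp
      then obtain n where n: "n \<in> S" "L ^ j \<le> n" "n \<le> K * L ^ j" using gaps by blast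
      have "K * L ^ j < L ^ Suc j" using L2 by simp
      thus ?thesis using n by (meson le_less_trans)
    qed
    then obtain f where f: "\<And>j. j \<ge> 1 \<Longrightarrow> f j \<in> S \<and> L ^ j \<le> f j \<and> f j < L ^ Suc j" by metis
    have f_less: "f i < f j" if "1 \<le> i" "i < j" for i j
    proof -
      have "L ^ Suc i \<le> L ^ j" using that L2 by (intro power_increasing) auto
      thus ?thesis using f[of i] f[of j] that by force
    qed
    have "inj_on f {1..<J}"
      by (intro linorder_inj_onI) (use f_less in force)+
    moreover have "f ` {1..<J} \<subseteq> {n. 1 \<le> n \<and> n \<le> N \<and> n \<in> S}"
    proof clarify
      fix j assume j: "j \<in> {1..<J}"
      have "L ^ Suc j \<le> L ^ J" using j L2 by (intro power_increasing) auto
      moreover have "1 \<le> L ^ j" using L2 by simp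
      ultimately show "1 \<le> f j \<and> f j \<le> N \<and> f j \<in> S" using f[of j] j J(1) by force
    qed
    ultimately have "card {1..<J} \<le> card {n. 1 \<le> n \<and> n \<le> N \<and> n \<in> S}"
      by (intro card_inj_on_le) auto
    thus ?thesis using floor_le by simp
  qed
  ultimately show ?thesis by blast
qed

section \<open>Runs of close indices\<close>

text \<open>
  Half of the value of \<open>\<delta>\<close> at which \<open>(p + q) \<delta> + (p - q) \<bar>\<eta>\<bar>\<close> reaches \<open>1\<close>.
\<close>

definition closeness_threshold :: "int \<Rightarrow> int \<Rightarrow> real \<Rightarrow> real" where
  "closeness_threshold p q \<eta> = (1 - of_int (p - q) * \<bar>\<eta>\<bar>) / (2 * of_int (p + q))"

lemma closeness_threshold_bounds:
  fixes p q :: int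
  assumes "1 \<le> q" "q < p" and "of_int (p - q) * \<bar>\<eta>\<bar> < 1"
  shows "0 < closeness_threshold p q \<eta>" and "closeness_threshold p q \<eta> < 1 / 2"
    and "of_int (p + q) * closeness_threshold p q \<eta> + of_int (p - q) * \<bar>\<eta>\<bar> < 1"
proof -
  define t where "t = real_of_int (p - q) * \<bar>\<eta>\<bar>"
  define c where "c = real_of_int (p + q)"
  have eq: "closeness_threshold p q \<eta> = (1 - t) / (2 * c)"
    by (simp add: closeness_threshold_def t_def c_def)
  have "0 \<le> t" using assms by (auto simp: t_def intro!: mult_nonneg_nonneg)
  moreover have "t < 1" "c > 1" using assms by (simp_all add: t_def c_def)
  ultimately show "0 < closeness_threshold p q \<eta>" "closeness_threshold p q \<eta> < 1 / 2"
    and "of_int (p + q) * closeness_threshold p q \<eta> + of_int (p - q) * \<bar>\<eta>\<bar> < 1"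
    unfolding c_def[symmetric] t_def[symmetric] eq by (simp_all add: field_simps)
qed

text \<open>
  The difference \<open>q b - p a\<close> is an integer and equals
  \<open>p (x - \<eta> - a) - q (y - \<eta> - b) + (p - q) \<eta>\<close>, which is less than \<open>1\<close> in absolute value.
\<close>

lemma consecutive_nearest_integers:
  fixes p q a b :: int and x y \<eta> \<delta> :: real
  assumes "0 \<le> q" "q \<le> p" and step: "of_int q * y = of_int p * x"
    and small: "of_int (p + q) * \<delta> + of_int (p - q) * \<bar>\<eta>\<bar> < 1"
    and a: "\<bar>x - \<eta> - of_int a\<bar> \<le> \<delta>" and b: "\<bar>y - \<eta> - of_int b\<bar> \<le> \<delta>"
  shows "q * b = p * a"
proof -
  have "real_of_int (q * b - p * a)
      = of_int p * (x - \<eta> - of_int a) - of_int q * (y - \<eta> - of_int b) + of_int (p - q) * \<eta>"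
    using step by (simp add: algebra_simps)
  also have "\<bar>\<dots>\<bar> \<le> \<bar>of_int p * (x - \<eta> - of_int a)\<bar> + \<bar>of_int q * (y - \<eta> - of_int b)\<bar>
      + \<bar>of_int (p - q) * \<eta>\<bar>"
    by linarith
  also have "\<dots> \<le> of_int p * \<delta> + of_int q * \<delta> + of_int (p - q) * \<bar>\<eta>\<bar>"
    using assms by (intro add_mono) (auto simp: abs_mult intro!: mult_left_mono)
  also have "\<dots> < 1" using small by (simp add: algebra_simps)
  finally have "\<bar>q * b - p * a\<bar> < 1" by linarith
  thus ?thesis by simp
qed

text \<open>
  The condition on \<open>\<eta>\<close> is included so that a bound on the length of close runs can be stated
  uniformly in \<open>\<eta>\<close>; it is this uniformity that makes \<open>C\<close> independent of \<open>\<eta>\<close>.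
\<close>

definition close_run :: "int \<Rightarrow> int \<Rightarrow> real \<Rightarrow> real \<Rightarrow> nat \<Rightarrow> nat \<Rightarrow> bool" where
  "close_run p q \<xi> \<eta> m k \<longleftrightarrow> of_int (p - q) * \<bar>\<eta>\<bar> < 1 \<and>
     (\<forall>n\<in>{m..m + k}. dist_nearest_int (\<xi> * (of_int p / of_int q) ^ n - \<eta>)
        < closeness_threshold p q \<eta>)"

lemma nearest_integers_along_run:
  fixes p q :: int and \<xi> \<eta> :: real
  defines "a \<equiv> \<lambda>n. round (\<xi> * (of_int p / of_int q) ^ n - \<eta>)"
  assumes pq: "1 \<le> q" "q < p" and run: "close_run p q \<xi> \<eta> m k"
  shows "q ^ k * a (m + k) = p ^ k * a m"
proof -
  have eta: "of_int (p - q) * \<bar>\<eta>\<bar> < 1" using run by (simp add: close_run_def)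
  have close: "\<bar>\<xi> * (of_int p / of_int q) ^ n - \<eta> - of_int (a n)\<bar> \<le> closeness_threshold p q \<eta>"
    if "m \<le> n" "n \<le> m + k" for n
    using run that by (force simp: close_run_def dist_nearest_int_def a_def)
  have "q ^ i * a (m + i) = p ^ i * a m" if "i \<le> k" for i
    using that
  proof (induction i)
    case (Suc i)
    have "q * a (Suc (m + i)) = p * a (m + i)"
    proof (rule consecutive_nearest_integers)
      show "real_of_int q * (\<xi> * (of_int p / of_int q) ^ Suc (m + i))
          = of_int p * (\<xi> * (of_int p / of_int q) ^ (m + i))"
        using pq by simp
      show "of_int (p + q) * closeness_threshold p q \<eta> + of_int (p - q) * \<bar>\<eta>\<bar> < 1"
        using closeness_threshold_bounds(3)[OF pq eta] .
      show "\<bar>\<xi> * (of_int p / of_int q) ^ (m + i) - \<eta> - of_int (a (m + i))\<bar>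
          \<le> closeness_threshold p q \<eta>"
        using Suc.prems by (intro close) auto
      show "\<bar>\<xi> * (of_int p / of_int q) ^ Suc (m + i) - \<eta> - of_int (a (Suc (m + i)))\<bar>
          \<le> closeness_threshold p q \<eta>"
        using Suc.prems by (intro close) auto
    qed (use pq in auto)
    hence "q ^ Suc i * a (m + Suc i) = p * (q ^ i * a (m + i))" by (simp add: algebra_simps)
    also have "\<dots> = p ^ Suc i * a m" using Suc by simp
    finally show ?case .
  qed simp
  thus ?thesis by simp
qed

text \<open>The bound is independent of \<open>\<eta>\<close>, because \<open>p - q \<ge> 1\<close> forces \<open>\<bar>\<eta>\<bar> < 1\<close>.\<close>

lemma close_run_near_integer:
  fixes p q :: int and \<xi> \<eta> :: real
  assumes pq: "1 \<le> q" "q < p" and run: "close_run p q \<xi> \<eta> m k" and n: "m \<le> n" "n \<le> m + k"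
  shows "\<bar>\<xi> * (of_int p / of_int q) ^ n - of_int (round (\<xi> * (of_int p / of_int q) ^ n - \<eta>))\<bar> < 2"
proof -
  have eta: "of_int (p - q) * \<bar>\<eta>\<bar> < 1" using run by (simp add: close_run_def)
  have "1 * \<bar>\<eta>\<bar> \<le> of_int (p - q) * \<bar>\<eta>\<bar>" using pq by (intro mult_right_mono) auto
  hence "\<bar>\<eta>\<bar> < 1" using eta by simp
  moreover have "\<bar>\<xi> * (of_int p / of_int q) ^ n - \<eta>
      - of_int (round (\<xi> * (of_int p / of_int q) ^ n - \<eta>))\<bar> \<le> 1 / 2"
    using of_int_round_abs_le[of "\<xi> * (of_int p / of_int q) ^ n - \<eta>"] by linarith
  ultimately show ?thesis by linarith
qed

section \<open>Bounds on the length of a run\<close>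

text \<open>
  The first integer \<open>a\<close> of a run of length \<open>k\<close> is divisible by \<open>q\<^sup>k\<close>. Once \<open>\<bar>\<xi>\<bar> \<alpha>\<^sup>m \<ge> 2\<close>, it is nonzero
  and bounded by \<open>2 \<bar>\<xi>\<bar> \<alpha>\<^sup>m\<close>, so that \<open>2\<^sup>k \<le> 2 \<bar>\<xi>\<bar> \<alpha>\<^sup>m\<close>.
\<close>

lemma run_length_nonintegral_ratio:
  fixes p q :: int and \<xi> :: real
  assumes q: "2 \<le> q" and pq: "q < p" and cop: "coprime p q" and xi: "\<xi> \<noteq> 0"
  shows "\<exists>B m0. \<forall>\<eta> k. \<forall>m\<ge>m0. close_run p q \<xi> \<eta> m k \<longrightarrow> k \<le> B * (m + 1)"
proof -
  define \<alpha> :: real where "\<alpha> = of_int p / of_int q"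
  have alpha: "\<alpha> > 1" using q pq by (simp add: \<alpha>_def)
  obtain m0 where m0: "2 / \<bar>\<xi>\<bar> < \<alpha> ^ m0" using real_arch_pow[OF alpha] by blast
  \<comment> \<open>One power of \<open>2\<close> dominates both \<open>2 \<bar>\<xi>\<bar>\<close> and \<open>\<alpha>\<close>, so that \<open>2 \<bar>\<xi>\<bar> \<alpha>\<^sup>m \<le> 2\<^bsup>B(m+1)\<^esup>\<close>.\<close>
  obtain B where B: "max (2 * \<bar>\<xi>\<bar>) \<alpha> < 2 ^ B" using real_arch_pow[of 2] by fastforce
  have "k \<le> B * (m + 1)" if m: "m \<ge> m0" and run: "close_run p q \<xi> \<eta> m k" for \<eta> m k
  proof -
    define a where "a = (\<lambda>n. round (\<xi> * \<alpha> ^ n - \<eta>))"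
    have "2 / \<bar>\<xi>\<bar> < \<alpha> ^ m"
      using m0 power_increasing[OF m, of \<alpha>] alpha by linarith
    hence big: "2 < \<bar>\<xi>\<bar> * \<alpha> ^ m" using xi by (simp add: field_simps)
    have abs_x: "\<bar>\<xi> * \<alpha> ^ m\<bar> = \<bar>\<xi>\<bar> * \<alpha> ^ m" using alpha by (simp add: abs_mult)
    have near: "\<bar>\<xi> * \<alpha> ^ m - of_int (a m)\<bar> < 2"
      using close_run_near_integer[OF _ pq run, of m] q by (simp add: a_def \<alpha>_def)
    have "a m \<noteq> 0" using near big abs_x by auto
    have "q ^ k * a (m + k) = p ^ k * a m"
      using nearest_integers_along_run[OF _ pq run] q by (simp add: a_def \<alpha>_def)
    hence "q ^ k dvd p ^ k * a m" by (metis dvd_triv_left)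
    moreover have "coprime (q ^ k) (p ^ k)" using cop by (simp add: coprime_commute)
    ultimately have "q ^ k dvd a m" by (simp add: coprime_dvd_mult_right_iff)
    hence "q ^ k \<le> \<bar>a m\<bar>" using \<open>a m \<noteq> 0\<close> by (simp add: zdvd_imp_le)
    moreover have "2 ^ k \<le> q ^ k" using q by (intro power_mono) auto
    ultimately have "2 ^ k \<le> \<bar>a m\<bar>" by linarith
    hence "real_of_int (2 ^ k) \<le> of_int \<bar>a m\<bar>" by (simp only: of_int_le_iff)
    hence "2 ^ k \<le> \<bar>real_of_int (a m)\<bar>" by simp
    also have "\<dots> \<le> (2 * \<bar>\<xi>\<bar>) * \<alpha> ^ m" using near big abs_x by linarith
    also have "\<dots> \<le> 2 ^ B * (2 ^ B) ^ m"
      using B alpha by (intro mult_mono power_mono) auto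
    also have "\<dots> = 2 ^ (B * (m + 1))" by (simp add: power_add power_mult)
    finally show ?thesis by simp
  qed
  thus ?thesis by blast
qed

text \<open>
  Any natural number \<open>V\<close> above the exponent works: it lies outside the set whose supremum is the
  exponent, so the inequality with \<open>v = V\<close> holds for finitely many \<open>n\<close> only.
\<close>

lemma finite_diophantine_exponent_lower_bound:
  assumes "b \<ge> 2" and "diophantine_exponent b \<xi> < \<infinity>"
  obtains V n0 :: nat where
    "\<And>n. n \<ge> n0 \<Longrightarrow> 1 / of_int b ^ (n * V) \<le> dist_nearest_int (of_int b ^ n * \<xi>)"
proof -
  define A where "A = {v::real. infinite {n::nat. n > 0 \<and>
       dist_nearest_int (of_int b ^ n * \<xi>) < (of_int b ^ n) powr (- v)}}"
  obtain V :: nat where V: "diophantine_exponent b \<xi> < ereal (real V)"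
    using assms(2) less_PInf_Ex_of_nat by auto
  have "real V \<notin> A"
  proof
    assume "real V \<in> A"
    hence "ereal (real V) \<le> diophantine_exponent b \<xi>"
      unfolding diophantine_exponent_def A_def by (intro Sup_upper imageI)
    thus False using V by simp
  qed
  hence "finite {n::nat. n > 0 \<and>
       dist_nearest_int (of_int b ^ n * \<xi>) < (of_int b ^ n) powr (- real V)}"
    by (simp add: A_def)
  then obtain n0 where n0: "\<And>n. n > 0 \<Longrightarrow>
       dist_nearest_int (of_int b ^ n * \<xi>) < (of_int b ^ n) powr (- real V) \<Longrightarrow> n < n0"
    unfolding finite_nat_set_iff_bounded by blast
  have "1 / of_int b ^ (n * V) \<le> dist_nearest_int (of_int b ^ n * \<xi>)" if "n \<ge> Suc n0" for n
  proof -
    have "(of_int b ^ n) powr (- real V) \<le> dist_nearest_int (of_int b ^ n * \<xi>)"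
      using n0[of n] that by fastforce
    moreover have "(real_of_int b ^ n) powr (- real V) = 1 / of_int b ^ (n * V)"
      using assms(1) by (simp add: powr_minus powr_realpow power_mult divide_inverse)
    ultimately show ?thesis by simp
  qed
  thus thesis using that by blast
qed

text \<open>
  Along a run, \<open>\<xi> p\<^sup>n\<close> and its integer are both multiplied by \<open>p\<close> at each step, hence so is their
  distance. As the last distance is below \<open>2\<close>, the first one is below \<open>2 / p\<^sup>k\<close>.
\<close>

lemma run_length_integral_ratio:
  fixes p :: int and \<xi> :: real
  assumes p: "2 \<le> p" and exponent: "diophantine_exponent p \<xi> < \<infinity>"
  shows "\<exists>B m0. \<forall>\<eta> k. \<forall>m\<ge>m0. close_run p 1 \<xi> \<eta> m k \<longrightarrow> k \<le> B * (m + 1)"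
proof -
  obtain V n0 :: nat where V: "\<And>n. n \<ge> n0 \<Longrightarrow>
      1 / of_int p ^ (n * V) \<le> dist_nearest_int (of_int p ^ n * \<xi>)"
    using finite_diophantine_exponent_lower_bound[OF p exponent] by blast
  have "k \<le> (V + 1) * (m + 1)" if m: "m \<ge> n0" and run: "close_run p 1 \<xi> \<eta> m k" for \<eta> m k
  proof -
    define a where "a = (\<lambda>n. round (\<xi> * of_int p ^ n - \<eta>))"
    have "a (m + k) = p ^ k * a m"
      using nearest_integers_along_run[OF _ _ run] p by (simp add: a_def)
    hence "\<xi> * of_int p ^ (m + k) - of_int (a (m + k)) = of_int p ^ k * (\<xi> * of_int p ^ m - of_int (a m))"
      by (simp add: power_add algebra_simps)
    moreover have "\<bar>\<xi> * of_int p ^ (m + k) - of_int (a (m + k))\<bar> < 2"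
      using close_run_near_integer[OF _ _ run, of "m + k"] p by (simp add: a_def)
    ultimately have near: "of_int p ^ k * \<bar>\<xi> * of_int p ^ m - of_int (a m)\<bar> < 2"
      using p by (simp add: abs_mult)
    have "1 / of_int p ^ (m * V) \<le> \<bar>\<xi> * of_int p ^ m - of_int (a m)\<bar>"
      using V[OF m] round_diff_minimal[of "of_int p ^ m * \<xi>" "a m"]
      by (simp add: dist_nearest_int_def mult.commute)
    hence "of_int p ^ k * (1 / of_int p ^ (m * V)) \<le> of_int p ^ k * \<bar>\<xi> * of_int p ^ m - of_int (a m)\<bar>"
      using p by (intro mult_left_mono) auto
    hence "of_int p ^ k * (1 / of_int p ^ (m * V)) < (2 :: real)" using near by linarith
    hence "real_of_int p ^ k < 2 * of_int p ^ (m * V)" using p by (simp add: field_simps)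
    also have "\<dots> \<le> of_int p ^ (m * V + 1)" using p by simp
    finally have "k < m * V + 1" using p by (subst (asm) power_strict_increasing_iff) auto
    thus ?thesis by (simp add: algebra_simps)
  qed
  thus ?thesis by blast
qed

theorem theorem1p2:
  fixes p q :: int and \<alpha> :: real
  assumes "\<alpha> = of_int p / of_int q" and "\<alpha> > 1"
    and "gcd p q = 1" and "q \<ge> 1"
  shows "\<exists>(\<delta>\<^sub>1 :: real \<Rightarrow> real) (C :: real \<Rightarrow> real).
    \<forall>\<xi> \<eta>. \<xi> \<noteq> 0 \<longrightarrow> of_int (p - q) * \<bar>\<eta>\<bar> < 1 \<longrightarrow>
      (q = 1 \<longrightarrow> diophantine_exponent p \<xi> < \<infinity>) \<longrightarrow>
      0 < \<delta>\<^sub>1 \<eta> \<and> \<delta>\<^sub>1 \<eta> < 1 / 2 \<and> C \<xi> > 0 \<and>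
      (\<forall>N::nat. N \<ge> 1 \<longrightarrow>
        int (card {n::nat. 1 \<le> n \<and> n \<le> N \<and>
          dist_nearest_int (\<xi> * \<alpha> ^ n - \<eta>) \<ge> \<delta>\<^sub>1 \<eta>})
        \<ge> \<lfloor>C \<xi> * ln (real N)\<rfloor>)"
proof -
  define \<delta> where "\<delta> = closeness_threshold p q"
  define far where "far = (\<lambda>\<xi> \<eta>. {n::nat. dist_nearest_int (\<xi> * \<alpha> ^ n - \<eta>) \<ge> \<delta> \<eta>})"
  have pq: "q < p" using assms(1,2,4) by simp
  define admissible where "admissible = (\<lambda>\<xi> C. C > 0 \<and>
    (\<forall>\<eta>. of_int (p - q) * \<bar>\<eta>\<bar> < 1 \<longrightarrow> (\<forall>N::nat. N \<ge> 1 \<longrightarrow>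
      int (card {n. 1 \<le> n \<and> n \<le> N \<and> n \<in> far \<xi> \<eta>}) \<ge> \<lfloor>C * ln (real N)\<rfloor>)))"
  have "\<exists>C. admissible \<xi> C"
    if xi: "\<xi> \<noteq> 0" and exponent: "q = 1 \<longrightarrow> diophantine_exponent p \<xi> < \<infinity>" for \<xi>
  proof -
    have "\<exists>B m0. \<forall>\<eta> k. \<forall>m\<ge>m0. close_run p q \<xi> \<eta> m k \<longrightarrow> k \<le> B * (m + 1)"
    proof (cases "q = 1")
      case True
      thus ?thesis using run_length_integral_ratio[of p \<xi>] exponent pq by simp
    next
      case False
      moreover have "coprime p q" using assms(3) by (simp add: coprime_iff_gcd_eq_1)
      ultimately show ?thesis using assms(4) pq xi by (intro run_length_nonintegral_ratio) auto
    qed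
    then obtain B m0 where
      B: "\<forall>\<eta> k. \<forall>m\<ge>m0. close_run p q \<xi> \<eta> m k \<longrightarrow> k \<le> B * (m + 1)"
      by blast
    \<comment> \<open>A run from \<open>m\<close> ends by \<open>m + B (m + 1) + 1\<close>, which is at most \<open>(2 B + 2) m\<close> when \<open>m \<ge> 1\<close>.\<close>
    define K where "K = 2 * B + 2"
    have far_meets: "\<exists>n\<in>far \<xi> \<eta>. m \<le> n \<and> n \<le> K * m"
      if eta: "of_int (p - q) * \<bar>\<eta>\<bar> < 1" and m: "m \<ge> m0 + 1" for \<eta> m
    proof -
      define k where "k = B * (m + 1) + 1"
      have "\<not> close_run p q \<xi> \<eta> m k" using B[rule_format, of m \<eta> k] m by (auto simp: k_def)
      then obtain n where n: "n \<in> far \<xi> \<eta>" "m \<le> n" "n \<le> m + k"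
        using eta by (auto simp: close_run_def far_def \<delta>_def assms(1) not_less)
      have "m + k \<le> K * m"
        using m by (cases m) (auto simp: k_def K_def algebra_simps)
      thus ?thesis using n by (meson le_trans)
    qed
    obtain C where "C > 0" and
      C: "\<forall>S. (\<forall>m\<ge>m0 + 1. \<exists>n\<in>S. m \<le> n \<and> n \<le> K * m) \<longrightarrow>
            (\<forall>N\<ge>1. int (card {n::nat. 1 \<le> n \<and> n \<le> N \<and> n \<in> S}) \<ge> \<lfloor>C * ln (real N)\<rfloor>)"
      using log_count_of_bounded_ratio_gaps[of "m0 + 1" K] by blast
    show ?thesis unfolding admissible_def
    proof (intro exI[of _ C] conjI allI impI)
      fix \<eta> :: real and N :: nat
      assume "of_int (p - q) * \<bar>\<eta>\<bar> < 1" "N \<ge> 1"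
      thus "\<lfloor>C * ln (real N)\<rfloor> \<le> int (card {n. 1 \<le> n \<and> n \<le> N \<and> n \<in> far \<xi> \<eta>})"
        using C far_meets by blast
    qed fact
  qed
  then obtain C where
    C: "\<And>\<xi>. \<xi> \<noteq> 0 \<Longrightarrow> (q = 1 \<longrightarrow> diophantine_exponent p \<xi> < \<infinity>) \<Longrightarrow> admissible \<xi> (C \<xi>)"
    by metis
  have "0 < \<delta> \<eta>" "\<delta> \<eta> < 1 / 2" if "of_int (p - q) * \<bar>\<eta>\<bar> < 1" for \<eta>
    using closeness_threshold_bounds(1,2)[OF assms(4) pq that] by (simp_all add: \<delta>_def)
  moreover have "C \<xi> > 0 \<and> (\<forall>N::nat. N \<ge> 1 \<longrightarrow>
      int (card {n. 1 \<le> n \<and> n \<le> N \<and> dist_nearest_int (\<xi> * \<alpha> ^ n - \<eta>) \<ge> \<delta> \<eta>})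
      \<ge> \<lfloor>C \<xi> * ln (real N)\<rfloor>)"
    if "\<xi> \<noteq> 0" "of_int (p - q) * \<bar>\<eta>\<bar> < 1" "q = 1 \<longrightarrow> diophantine_exponent p \<xi> < \<infinity>" for \<xi> \<eta>
    using C[OF that(1,3)] that(2) unfolding admissible_def far_def mem_Collect_eq by blast
  ultimately show ?thesis
    by (intro exI[of _ \<delta>] exI[of _ C] allI impI conjI) auto
qed

end
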